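(* Let $H$ be a finite simple graph with $\Delta(H)\le 2$, and let $G$ be obtained from $H$ by gluing in vertex-disjoint copies of $K_4$, i.e. there are pairwise disjoint $4$-element subsets $Y_1,\dots,Y_q\subseteq V(H)$ and $G$ has vertex set $V(H)$ and edge set $E(H)\cup\{uv: u\neq v,\ u,v\in Y_j \text{ for some } j\}$. Let $\mathcal{C}$ be the set of odd cycles of $H$ of length greater than $3$, and let $V(\mathcal{C})$ be the set of vertices lying on these cycles. Then there is a set $Z\subseteq V(\mathcal{C})$ with $|Z|\le |\mathcal{C}|/2$ such that $G-Z$ is $4$-colorable and $Z$ contains at most one vertex from each cycle of $\mathcal{C}$. Moreover, $|V(G)\setminus Z|\ge \tfrac{9}{10}|V(G)|$.
   Context: All graphs are finite and simple; the cycles of $H$ are its cycle components. *)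

theory Defs
  imports Complex_Main
begin

definition simple_graph :: "'a set \<Rightarrow> ('a \<Rightarrow> 'a \<Rightarrow> bool) \<Rightarrow> bool" where
  "simple_graph V E \<longleftrightarrow> finite V \<and> (\<forall>u v. E u v \<longrightarrow> u \<in> V \<and> v \<in> V \<and> u \<noteq> v \<and> E v u)"

definition degree :: "'a set \<Rightarrow> ('a \<Rightarrow> 'a \<Rightarrow> bool) \<Rightarrow> 'a \<Rightarrow> nat" where
  "degree V E v = card {u \<in> V. E v u}"

definition max_degree_le :: "'a set \<Rightarrow> ('a \<Rightarrow> 'a \<Rightarrow> bool) \<Rightarrow> nat \<Rightarrow> bool" where
  "max_degree_le V E d \<longleftrightarrow> (\<forall>v\<in>V. degree V E v \<le> d)"

definition component :: "'a set \<Rightarrow> ('a \<Rightarrow> 'a \<Rightarrow> bool) \<Rightarrow> 'a \<Rightarrow> 'a set" where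
  "component V E v = {u. (\<lambda>x y. x \<in> V \<and> y \<in> V \<and> E x y)\<^sup>*\<^sup>* v u}"

text \<open>A cycle of H is a connected component that is a cycle, i.e. connected,
at least 3 vertices and all vertices of degree 2; represented by its vertex set.\<close>
definition cycle_component :: "'a set \<Rightarrow> ('a \<Rightarrow> 'a \<Rightarrow> bool) \<Rightarrow> 'a set \<Rightarrow> bool" where
  "cycle_component V E C \<longleftrightarrow> (\<exists>v\<in>V. C = component V E v) \<and> card C \<ge> 3 \<and>
     (\<forall>x\<in>C. degree V E x = 2)"

definition long_odd_cycles :: "'a set \<Rightarrow> ('a \<Rightarrow> 'a \<Rightarrow> bool) \<Rightarrow> 'a set set" where
  "long_odd_cycles V E = {C. cycle_component V E C \<and> odd (card C) \<and> card C > 3}"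

definition glue_cliques :: "('a \<Rightarrow> 'a \<Rightarrow> bool) \<Rightarrow> (nat \<Rightarrow> 'a set) \<Rightarrow> nat \<Rightarrow> 'a \<Rightarrow> 'a \<Rightarrow> bool" where
  "glue_cliques E Y q u v \<longleftrightarrow> E u v \<or> (u \<noteq> v \<and> (\<exists>j<q. u \<in> Y j \<and> v \<in> Y j))"

definition colorable :: "'a set \<Rightarrow> ('a \<Rightarrow> 'a \<Rightarrow> bool) \<Rightarrow> nat \<Rightarrow> bool" where
  "colorable W E k \<longleftrightarrow> (\<exists>c :: 'a \<Rightarrow> nat. (\<forall>v\<in>W. c v < k) \<and>
      (\<forall>u\<in>W. \<forall>v\<in>W. E u v \<longrightarrow> c u \<noteq> c v))"

end

theory Submission
  imports Defs "HOL-Combinatorics.Orbits"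
begin

text \<open>
  Split each clique \<open>Y\<^sub>j\<close> into two pairs; these form a matching \<open>P\<close>. The edges of \<open>H\<close> lie on the
  arcs of a permutation \<open>f\<close> of \<open>V\<close>. Choose a second matching \<open>M\<close> of arcs covering every orbit of \<open>f\<close>
  except for one vertex \<open>z\<close> in each odd orbit. The graph \<open>P \<union> M\<close> is bipartite, and a 2-colouring \<open>c\<close>
  of it cuts every \<open>Y\<^sub>j\<close> into two halves. Every vertex other than the \<open>z\<close> has a neighbour of the
  other colour along its orbit, so inside a colour class \<open>H\<close> has maximum degree 1; together with the
  halves of the \<open>Y\<^sub>j\<close> this is again a union of two matchings, hence 2-colourable, which gives four
  colours. On triangles and on orbits with an arc outside \<open>H\<close> the vertex \<open>z\<close> does no harm.

  A component of \<open>P \<union> M\<close> is a path or an even cycle, so it has at most two vertices not yet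
  covered by \<open>M\<close>. Treating the long odd cycles \<open>C\<close> one after the other, parity yields a vertex \<open>z\<close> of
  \<open>C\<close> whose component contains no other vertex of \<open>C\<close>; if its other end lies on an untreated
  cycle \<open>C'\<close>, that end is the exceptional vertex of \<open>C'\<close>. Thus in the end no exceptional vertex
  shares its component with another vertex of its cycle, and flipping the colouring on components
  suitably makes at least half of the exceptional vertices differ from their successors.
  The others form \<open>Z\<close>.
\<close>

section \<open>Unions of two matchings: component labels and 2-colourings\<close>

definition matching :: "'a set set \<Rightarrow> bool" where
  "matching N \<longleftrightarrow> (\<forall>e\<in>N. card e = 2) \<and> pairwise disjnt N"

text \<open>
  Here \<open>l\<close> labels the components of the graph \<open>F\<close>, \<open>c\<close> is a 2-colouring of it, and \<open>U\<close> consists of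
  the vertices that may still receive an edge. The second clause encodes that components are
  alternating paths: two free ends have opposite colours, and as there are only two colours
  a component has at most two free ends.
\<close>

definition linked :: "('a \<Rightarrow> bool) \<Rightarrow> ('a \<Rightarrow> 'b) \<Rightarrow> 'a set set \<Rightarrow> 'a set \<Rightarrow> bool" where
  "linked c l F U \<longleftrightarrow>
     (\<forall>e\<in>F. \<forall>u\<in>e. \<forall>v\<in>e. u \<noteq> v \<longrightarrow> l u = l v \<and> c u \<noteq> c v) \<and>
     (\<forall>u\<in>U. \<forall>v\<in>U. u \<noteq> v \<longrightarrow> l u = l v \<longrightarrow> c u \<noteq> c v)"

lemma linkedD:
  assumes "linked c l F U" "e \<in> F" "u \<in> e" "v \<in> e" "u \<noteq> v"
  shows "l u = l v" "c u \<noteq> c v"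
  using assms unfolding linked_def by blast+

lemma linked_free:
  assumes "linked c l F U" "u \<in> U" "v \<in> U" "u \<noteq> v" "l u = l v"
  shows "c u \<noteq> c v"
  using assms unfolding linked_def by blast

lemma linked_mono:
  "linked c l F U \<Longrightarrow> F' \<subseteq> F \<Longrightarrow> U' \<subseteq> U \<Longrightarrow> linked c l F' U'"
  unfolding linked_def by blast

text \<open>The components of a single matching are its edges and the unmatched vertices, so each
  can serve as its own label, and the colour marks one chosen vertex of each. No second matching has
  been added yet, hence every vertex is free.\<close>

lemma linked_matching:
  assumes "matching P"
  shows "\<exists>c (l :: 'a \<Rightarrow> 'a set). linked c l P UNIV"
proof -
  define l where "l u = insert u (\<Union>{e \<in> P. u \<in> e})" for u :: 'a
  define c where "c u = (u = (SOME x. x \<in> l u))" for u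
  have le: "l u = e" if "e \<in> P" "u \<in> e" for u e
    using assms that unfolding matching_def pairwise_def disjnt_def l_def by fast
  have other: "l u = {u} \<or> l u \<in> P \<and> u \<in> l u" for u
    by (cases "\<exists>e\<in>P. u \<in> e") (auto simp: l_def dest: le[unfolded l_def])
  have sm: "(SOME x. x \<in> l u) \<in> l u" for u
    by (rule someI[of _ u]) (simp add: l_def)
  have "c u \<noteq> c v" if "u \<noteq> v" "l u = l v" for u v
  proof -
    have "u \<in> l u" "v \<in> l v" by (simp_all add: l_def)
    then have "l u \<in> P" "u \<in> l u" "v \<in> l u" using other that by force+
    then have "card (l u) = 2" using assms by (auto simp: matching_def)
    then have "l u = {u, v}" using \<open>u \<in> l u\<close> \<open>v \<in> l u\<close> that
      by (auto simp: card_2_iff)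
    then have "(SOME x. x \<in> l u) \<in> {u, v}" using sm[of u] by simp
    then show ?thesis using that unfolding c_def by auto
  qed
  then have "linked c l P UNIV"
    unfolding linked_def by (intro conjI ballI impI) (simp_all add: le)
  then show ?thesis by blast
qed

text \<open>Two free vertices with one label are opposite-coloured ends of a path, which the new
  edge closes to an even cycle. With different labels two paths are joined, after flipping the
  colours of one if necessary. The last conjunct compares label classes, because an unchanged label
  alone would not exclude newcomers to a component.\<close>

lemma linked_add_edge:
  fixes l :: "'a \<Rightarrow> 'b"
  assumes L: "linked c l F U" and ab: "a \<in> U" "b \<in> U" "a \<noteq> b"
  shows "\<exists>c' (l' :: 'a \<Rightarrow> 'b). linked c' l' (insert {a, b} F) (U - {a, b}) \<and>
           (\<forall>w. l w \<noteq> l a \<longrightarrow> l w \<noteq> l b \<longrightarrow> {v. l' v = l' w} = {v. l v = l w})"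
proof (cases "l a = l b")
  case True
  have "linked c l (insert {a, b} F) (U - {a, b})"
    unfolding linked_def
  proof (intro conjI ballI impI)
    fix e u v assume *: "e \<in> insert {a, b} F" "u \<in> e" "v \<in> e" "u \<noteq> v"
    show "l u = l v"
      using * linkedD(1)[OF L, of e u v] True by auto
    show "c u \<noteq> c v"
      using * linkedD(2)[OF L, of e u v] linked_free[OF L ab True] by auto
  qed (use linked_free[OF L] in blast)
  then show ?thesis by blast
next
  case False
  define l' where "l' v = (if l v = l b then l a else l v)" for v
  \<comment> \<open>An exclusive or: the component of \<open>b\<close> is flipped exactly when
    \<open>a\<close> and \<open>b\<close> have the same colour.\<close>
  define c' where "c' v = (c v \<noteq> (l v = l b \<and> c a = c b))" for v
  have "linked c' l' (insert {a, b} F) (U - {a, b})"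
    unfolding linked_def
  proof (intro conjI ballI impI)
    fix e u v assume *: "e \<in> insert {a, b} F" "u \<in> e" "v \<in> e" "u \<noteq> v"
    show "l' u = l' v"
      using * linkedD(1)[OF L, of e u v] by (auto simp: l'_def)
    show "c' u \<noteq> c' v"
      using * linkedD[OF L, of e u v] False by (auto simp: c'_def)
  next
    fix u v assume *: "u \<in> U - {a, b}" "v \<in> U - {a, b}" "u \<noteq> v" "l' u = l' v"
    have f: "c x \<longleftrightarrow> \<not> c y" if "x \<in> U" "y \<in> U" "x \<noteq> y" "l x = l y" for x y
      using linked_free[OF L that] by blast
    \<comment> \<open>In the last two cases \<open>u\<close> and \<open>v\<close> are the far ends
      of the joined paths, so each had the colour opposite to the near end of its own path.\<close>
    consider "l u = l v" | "l u = l b" "l v = l a" | "l u = l a" "l v = l b"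
      using *(4) by (auto simp: l'_def split: if_splits)
    then show "c' u \<noteq> c' v"
    proof cases
      case 1
      then have "c u \<longleftrightarrow> \<not> c v" using f * by blast
      then show ?thesis using 1 by (auto simp: c'_def)
    next
      case 2
      then have "c u \<longleftrightarrow> \<not> c b" "c v \<longleftrightarrow> \<not> c a" using f * ab by blast+
      then show ?thesis using 2 False by (auto simp: c'_def)
    next
      case 3
      then have "c v \<longleftrightarrow> \<not> c b" "c u \<longleftrightarrow> \<not> c a" using f * ab by blast+
      then show ?thesis using 3 False by (auto simp: c'_def)
    qed
  qed
  moreover have "\<forall>w. l w \<noteq> l a \<longrightarrow> l w \<noteq> l b \<longrightarrow> {v. l' v = l' w} = {v. l v = l w}"
    by (auto simp: l'_def)
  ultimately show ?thesis by blast
qed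

text \<open>
  The additional clause says that a component without free vertices is never changed again.
\<close>

lemma linked_add_matching:
  fixes l :: "'a \<Rightarrow> 'b"
  assumes "finite N" "matching N" "linked c l F U" "\<Union>N \<subseteq> U"
  shows "\<exists>c' (l' :: 'a \<Rightarrow> 'b). linked c' l' (N \<union> F) (U - \<Union>N) \<and>
           (\<forall>w. (\<forall>a\<in>\<Union>N. l a \<noteq> l w) \<longrightarrow> {v. l' v = l' w} = {v. l v = l w})"
  using assms
proof (induction N)
  case empty
  then have "linked c l ({} \<union> F) (U - \<Union>{})" by simp
  then show ?case by blast
next
  case (insert e N)
  have "matching N" "card e = 2" and dj: "e \<inter> \<Union>N = {}"
    using insert.prems(1) insert.hyps(2)
    by (auto simp: matching_def pairwise_insert disjnt_def)
  then obtain c1 and l1 :: "'a \<Rightarrow> 'b" where 1: "linked c1 l1 (N \<union> F) (U - \<Union>N)"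
      "\<forall>w. (\<forall>a\<in>\<Union>N. l a \<noteq> l w) \<longrightarrow> {v. l1 v = l1 w} = {v. l v = l w}"
    using insert by auto
  obtain a b where e: "e = {a, b}" "a \<noteq> b"
    using \<open>card e = 2\<close> by (meson card_2_iff)
  have "a \<in> U - \<Union>N" "b \<in> U - \<Union>N" using insert.prems(3) dj e by auto
  from linked_add_edge[OF 1(1) this e(2)] obtain c2 and l2 :: "'a \<Rightarrow> 'b" where
    2: "linked c2 l2 (insert {a, b} (N \<union> F)) (U - \<Union>N - {a, b})"
      "\<forall>w. l1 w \<noteq> l1 a \<longrightarrow> l1 w \<noteq> l1 b \<longrightarrow> {v. l2 v = l2 w} = {v. l1 v = l1 w}"
    by blast
  have "{v. l2 v = l2 w} = {v. l v = l w}" if w: "\<forall>a\<in>\<Union>(insert e N). l a \<noteq> l w" for w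
  proof -
    have *: "{v. l1 v = l1 w} = {v. l v = l w}" using 1(2) w by auto
    have "l1 a \<noteq> l1 w" "l1 b \<noteq> l1 w" using * w e by auto
    then show ?thesis using 2(2) * by auto
  qed
  moreover have "U - \<Union>N - {a, b} = U - \<Union>(insert e N)" using e by auto
  then have "linked c2 l2 (insert e N \<union> F) (U - \<Union>(insert e N))"
    using 2(1) e by simp
  ultimately show ?case by blast
qed

text \<open>Cycles alternate between the two matchings and so are even. \<open>Q\<close> is finite
  because its edges are added to \<open>P\<close> one at a time.\<close>

lemma two_matchings_bipartite:
  assumes "matching P" "matching Q" "finite Q"
  shows "\<exists>c. \<forall>e\<in>P \<union> Q. \<forall>u\<in>e. \<forall>v\<in>e. u \<noteq> v \<longrightarrow> c u \<noteq> (c v :: bool)"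
proof -
  obtain c and l :: "'a \<Rightarrow> 'a set" where "linked c l P UNIV"
    using linked_matching[OF assms(1)] by blast
  from linked_add_matching[OF assms(3,2) this subset_UNIV] obtain c' and l' :: "'a \<Rightarrow> 'a set" where
    L: "linked c' l' (Q \<union> P) (UNIV - \<Union>Q)" by blast
  show ?thesis
    by (intro exI[of _ c'] ballI impI, rule linkedD(2)[OF L]) auto
qed

lemma relation_matching:
  assumes "\<And>u v. R u v \<Longrightarrow> R v u \<and> u \<noteq> v" "\<And>u v w. R u v \<Longrightarrow> R u w \<Longrightarrow> v = w"
  shows "matching {{u, v} |u v. R u v}"
  unfolding matching_def pairwise_def disjnt_def
proof (intro conjI ballI impI)
  fix e f assume *: "e \<in> {{u, v} |u v. R u v}" "f \<in> {{u, v} |u v. R u v}" "e \<noteq> f"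
  show "e \<inter> f = {}"
  proof (rule ccontr)
    assume "e \<inter> f \<noteq> {}"
    then obtain x where x: "x \<in> e" "x \<in> f" by blast
    from *(1) x(1) obtain y where y: "e = {x, y}" "R x y" using assms(1) by blast
    from *(2) x(2) obtain y' where y': "f = {x, y'}" "R x y'" using assms(1) by blast
    show False using y y' assms(2) *(3) by blast
  qed
next
  fix e assume "e \<in> {{u, v} |u v. R u v}"
  then obtain u v where "e = {u, v}" "R u v" by blast
  then show "card e = 2" using assms(1)[of u v] by simp
qed

text \<open>A symmetric irreflexive relation with unique partners is a matching. In this form the
  result serves twice: to orient \<open>H\<close>, and to split the colour classes at the
  end.\<close>

lemma two_relations_bipartite:
  assumes "\<And>u v. R u v \<Longrightarrow> R v u \<and> u \<noteq> v" "\<And>u v w. R u v \<Longrightarrow> R u w \<Longrightarrow> v = w"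
    and "\<And>u v. S u v \<Longrightarrow> S v u \<and> u \<noteq> v" "\<And>u v w. S u v \<Longrightarrow> S u w \<Longrightarrow> v = w"
    and "finite A" "\<And>u v. S u v \<Longrightarrow> u \<in> A"
  shows "\<exists>c. \<forall>u v. R u v \<or> S u v \<longrightarrow> c u \<noteq> (c v :: bool)"
proof -
  let ?P = "{{u, v} |u v. R u v}" and ?Q = "{{u, v} |u v. S u v}"
  have m: "matching ?P" "matching ?Q"
    by (rule relation_matching[of R, OF assms(1,2)] relation_matching[of S, OF assms(3,4)]; assumption)+
  have "e \<in> Pow A" if "e \<in> ?Q" for e
  proof -
    from that obtain u v where "e = {u, v}" "S u v" by blast
    then show ?thesis using assms(3)[of u v] assms(6)[of u v] assms(6)[of v u] by simp
  qed
  then have "?Q \<subseteq> Pow A" by blast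
  then have "finite ?Q" using finite_subset \<open>finite A\<close> by blast
  from two_matchings_bipartite[OF m this]
  obtain c where c: "\<forall>e\<in>?P \<union> ?Q. \<forall>u\<in>e. \<forall>v\<in>e. u \<noteq> v \<longrightarrow> c u \<noteq> (c v :: bool)"
    by (rule exE)
  show ?thesis
  proof (intro exI[of _ c] allI impI)
    fix u v assume *: "R u v \<or> S u v"
    then have "{u, v} \<in> ?P \<union> ?Q" by blast
    moreover have "u \<noteq> v" using * assms(1,3)[of u v] by blast
    ultimately show "c u \<noteq> c v" using c by blast
  qed
qed

section \<open>Choosing signs for the components\<close>

text \<open>Under random signs each condition holds with probability one half, since
  \<open>a i\<close> and \<open>b i\<close> differ. The induction derandomises this: the sign of
  \<open>x\<close> is chosen last, for the indices \<open>K\<close> that involve \<open>x\<close>,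
  while those in \<open>J\<close> are settled by the smaller label set.\<close>

lemma signs_half:
  fixes a b :: "'i \<Rightarrow> 'b"
  assumes "finite L" "finite I" "\<And>i. i \<in> I \<Longrightarrow> a i \<in> L \<and> b i \<in> L \<and> a i \<noteq> b i"
  shows "\<exists>s :: 'b \<Rightarrow> bool. 2 * card {i\<in>I. (s (a i) \<noteq> s (b i)) = t i} \<le> card I"
  using assms
proof (induction L arbitrary: I)
  case empty
  then have "I = {}" by auto
  then show ?case by simp
next
  case (insert x L)
  define J where "J = {i\<in>I. a i \<noteq> x \<and> b i \<noteq> x}"
  define K where "K = I - J"
  have JK: "J \<inter> K = {}" "I = J \<union> K" "finite J" "finite K"
    using insert.prems(1) by (auto simp: J_def K_def)
  have "\<exists>s :: 'b \<Rightarrow> bool. 2 * card {i\<in>J. (s (a i) \<noteq> s (b i)) = t i} \<le> card J"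
  proof (rule insert.IH)
    show "a i \<in> L \<and> b i \<in> L \<and> a i \<noteq> b i" if "i \<in> J" for i
      using insert.prems(2)[of i] that by (auto simp: J_def)
  qed fact
  then obtain s :: "'b \<Rightarrow> bool" where s: "2 * card {i\<in>J. (s (a i) \<noteq> s (b i)) = t i} \<le> card J" by blast
  define B where "B v = {i\<in>K. ((s(x := v)) (a i) \<noteq> (s(x := v)) (b i)) = t i}" for v
  \<comment> \<open>For an index in \<open>K\<close> exactly one of \<open>a i\<close>,
    \<open>b i\<close> is \<open>x\<close>, so changing the sign of \<open>x\<close> toggles its
    condition.\<close>
  have "B True \<union> B False \<subseteq> K" "B True \<inter> B False = {}" 
    using insert.prems by (auto simp: B_def J_def K_def)
  then have "card (B True) + card (B False) \<le> card K"
    using JK by (metis card_Un_disjoint card_mono finite_Un finite_subset)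
  then obtain v where v: "2 * card (B v) \<le> card K"
    by (cases "card (B True) \<le> card (B False)") (use that[of True] that[of False] in linarith)+
  have "{i\<in>I. ((s(x := v)) (a i) \<noteq> (s(x := v)) (b i)) = t i} =
     {i\<in>J. (s (a i) \<noteq> s (b i)) = t i} \<union> B v"
    by (auto simp: J_def K_def B_def)
  then have "card {i\<in>I. ((s(x := v)) (a i) \<noteq> (s(x := v)) (b i)) = t i} \<le>
     card {i\<in>J. (s (a i) \<noteq> s (b i)) = t i} + card (B v)"
    by (simp add: card_Un_le)
  moreover have "card I = card J + card K" using JK by (simp add: card_Un_disjoint)
  ultimately show ?case using s v by (intro exI[of _ "s(x := v)"]) linarith
qed

section \<open>Exceptional vertices of odd cycles\<close>

lemma matching_UN:
  assumes "pairwise disjnt K" "\<And>C. C \<in> K \<Longrightarrow> matching (M C)" "\<And>C. C \<in> K \<Longrightarrow> \<Union>(M C) \<subseteq> C"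
  shows "matching (\<Union>C\<in>K. M C)"
  unfolding matching_def
proof (intro conjI ballI pairwiseI)
  fix e assume "e \<in> (\<Union>C\<in>K. M C)"
  then show "card e = 2" using assms(2) by (auto simp: matching_def)
next
  fix e f assume "e \<in> (\<Union>C\<in>K. M C)" "f \<in> (\<Union>C\<in>K. M C)" "e \<noteq> f"
  then obtain C D where *: "C \<in> K" "D \<in> K" "e \<in> M C" "f \<in> M D" by blast
  show "disjnt e f"
  proof (cases "C = D")
    case True
    then show ?thesis using assms(2)[OF *(1)] * \<open>e \<noteq> f\<close> by (auto simp: matching_def pairwise_def)
  next
    case False
    then have "disjnt C D" using assms(1) * by (simp add: pairwise_def)
    then show ?thesis using assms(3)[OF *(1)] assms(3)[OF *(2)] *(3,4) by (fastforce simp: disjnt_def)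
  qed
qed

text \<open>A label occurs at most once per colour, hence at most twice. If every label in
  \<open>A\<close> occurred twice, both colours would carry the same labels and \<open>A\<close>
  would have even size. Oddness also makes \<open>A\<close> finite, as \<open>card\<close> is 0 on
  infinite sets.\<close>

lemma odd_card_isolated_label:
  assumes "odd (card A)" and c: "\<And>u v. u \<in> A \<Longrightarrow> v \<in> A \<Longrightarrow> u \<noteq> v \<Longrightarrow> l u = l v \<Longrightarrow> c u \<noteq> (c v :: bool)"
  shows "\<exists>z\<in>A. \<forall>v\<in>A. l v = l z \<longrightarrow> v = z"
proof (rule ccontr)
  assume neg: "\<not> ?thesis"
  define T where "T b = {v\<in>A. c v = b}" for b
  have fin: "finite A" using \<open>odd (card A)\<close> card.infinite by fastforce
  have inj: "inj_on l (T b)" for b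
    using c unfolding inj_on_def T_def by blast
  have sub: "l ` T b \<subseteq> l ` T (\<not> b)" for b
  proof
    fix y assume "y \<in> l ` T b"
    then obtain z where z: "z \<in> A" "c z = b" "y = l z" by (auto simp: T_def)
    then obtain v where "v \<in> A" "l v = l z" "v \<noteq> z" using neg by blast
    then show "y \<in> l ` T (\<not> b)" using c[of v z] z by (auto simp: T_def intro!: image_eqI[of _ _ v])
  qed
  have "l ` T True = l ` T False" using sub[of True] sub[of False] by auto
  then have eq: "card (T True) = card (T False)" using inj by (metis card_image)
  have "A = T True \<union> T False" "T True \<inter> T False = {}" by (auto simp: T_def)
  then have "card A = card (T True) + card (T False)" using fin by (metis card_Un_disjoint finite_Un)
  then show False using eq \<open>odd (card A)\<close> by simp
qed

text \<open>Cycles are treated in batches: the component of an isolated vertex \<open>z\<close> has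
  at most two free vertices, and the cycles through them are treated together, with these vertices
  as exceptional ones. Afterwards that component has no free vertex and stays fixed; the last
  conjunct carries this through the induction.\<close>

lemma linked_resolve_odd:
  fixes l :: "'a \<Rightarrow> 'b" and Nf :: "'a set \<Rightarrow> 'a \<Rightarrow> 'a set set"
  assumes "finite L" "pairwise disjnt L" "\<And>C. C \<in> L \<Longrightarrow> odd (card C)"
    and "\<And>C z. C \<in> L \<Longrightarrow> z \<in> C \<Longrightarrow> matching (Nf C z) \<and> \<Union>(Nf C z) = C - {z}"
    and "linked c l F (\<Union>L)"
  shows "\<exists>\<zeta> c' (l' :: 'a \<Rightarrow> 'b). linked c' l' ((\<Union>C\<in>L. Nf C (\<zeta> C)) \<union> F) {} \<and>
           (\<forall>C\<in>L. \<zeta> C \<in> C \<and> (\<forall>v\<in>C. l' v = l' (\<zeta> C) \<longrightarrow> v = \<zeta> C)) \<and>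
           (\<forall>w. (\<forall>a\<in>\<Union>L. l a \<noteq> l w) \<longrightarrow> {v. l' v = l' w} = {v. l v = l w})"
  using assms
proof (induction L arbitrary: c l F rule: finite_psubset_induct)
  case (psubset L)
  show ?case
  proof (cases "L = {}")
    case True
    then have "linked c l ((\<Union>C\<in>L. Nf C (undefined C)) \<union> F) {}"
      using psubset.prems(4) by simp
    then show ?thesis using True by blast
  next
    case False
    then obtain C where C: "C \<in> L" by blast
    have "\<exists>z\<in>C. \<forall>v\<in>C. l v = l z \<longrightarrow> v = z"
      by (rule odd_card_isolated_label[of C l c])
        (use psubset.prems(2) linked_free[OF psubset.prems(4)] C in auto)
    then obtain z where z: "z \<in> C" "\<And>v. v \<in> C \<Longrightarrow> l v = l z \<Longrightarrow> v = z" by blast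
    have dj: "A = B" if "A \<in> L" "B \<in> L" "x \<in> A" "x \<in> B" for A B x
      using psubset.prems(1) that unfolding pairwise_def disjnt_def by blast
    have fin: "finite A" if "A \<in> L" for A
      using psubset.prems(2)[OF that] card.infinite by fastforce
    \<comment> \<open>\<open>D\<close> contains the free ends of the component of \<open>z\<close>, so at most two vertices, on distinct cycles.\<close>
    define D where "D = {u\<in>\<Union>L. l u = l z}"
    define K where "K = {A\<in>L. A \<inter> D \<noteq> {}}"
    have "C \<in> K" using C z by (auto simp: K_def D_def)
    \<comment> \<open>On a cycle other than \<open>C\<close>, two vertices of \<open>D\<close>
      together with \<open>z\<close> would be three free vertices of one component, pairwise of
      different colours.\<close>
    have one: "u = v" if "A \<in> L" "u \<in> A \<inter> D" "v \<in> A \<inter> D" for A u v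
    proof (cases "A = C")
      case True
      then show ?thesis using that z by (auto simp: D_def)
    next
      case False
      then have "u \<noteq> z" "v \<noteq> z" using dj C z that by blast+
      moreover have "u \<in> \<Union>L" "v \<in> \<Union>L" "z \<in> \<Union>L" "l u = l z" "l v = l z" using that C z by (auto simp: D_def)
      ultimately have "c u \<noteq> c z" "c v \<noteq> c z" "u \<noteq> v \<Longrightarrow> c u \<noteq> c v"
        using linked_free[OF psubset.prems(4)] by (metis, metis, metis)
      then show ?thesis by blast
    qed
    define \<zeta>0 where "\<zeta>0 A = (SOME u. u \<in> A \<inter> D)" for A
    have \<zeta>0: "\<zeta>0 A \<in> A \<inter> D" if "A \<in> K" for A
      using that some_in_eq[of "A \<inter> D"] by (auto simp: \<zeta>0_def K_def)
    have N1: "matching (Nf A (\<zeta>0 A))" "\<Union>(Nf A (\<zeta>0 A)) = A - D" if "A \<in> K" for A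
    proof -
      have A: "A \<in> L" using that by (simp add: K_def)
      show "matching (Nf A (\<zeta>0 A))" using psubset.prems(3)[OF A] \<zeta>0[OF that] by blast
      have "A \<inter> D = {\<zeta>0 A}" using one[OF A] \<zeta>0[OF that] by blast
      then show "\<Union>(Nf A (\<zeta>0 A)) = A - D" using psubset.prems(3)[OF A, of "\<zeta>0 A"] by auto
    qed
    define N where "N = (\<Union>A\<in>K. Nf A (\<zeta>0 A))"
    have UN: "\<Union>N = \<Union>K - D" unfolding N_def using N1(2) by blast
    have "K \<subseteq> L" by (auto simp: K_def)
    have "matching N" unfolding N_def
      by (rule matching_UN) (use N1 pairwise_subset[OF psubset.prems(1) \<open>K \<subseteq> L\<close>] in auto)
    have "finite (\<Union>K)" using fin \<open>K \<subseteq> L\<close> finite_subset[OF \<open>K \<subseteq> L\<close>] psubset.hyps(1) by blast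
    then have "finite N" using UN by (metis finite_Diff finite_UnionD)
    have "\<Union>N \<subseteq> \<Union>L" using UN \<open>K \<subseteq> L\<close> by blast
    from linked_add_matching[OF \<open>finite N\<close> \<open>matching N\<close> psubset.prems(4) this]
    obtain c1 and l1 :: "'a \<Rightarrow> 'b" where 1: "linked c1 l1 (N \<union> F) (\<Union>L - \<Union>N)"
      and cl1: "\<And>w. (\<forall>a\<in>\<Union>N. l a \<noteq> l w) \<Longrightarrow> {v. l1 v = l1 w} = {v. l v = l w}" by blast
    \<comment> \<open>The exceptional vertices in \<open>D\<close> are not covered by
      \<open>N\<close>; they cease to be free by restricting to the untreated cycles.\<close>
    have "\<Union>(L - K) \<subseteq> \<Union>L - \<Union>N" using UN dj \<open>K \<subseteq> L\<close> by fast
    then have 1: "linked c1 l1 (N \<union> F) (\<Union>(L - K))" using linked_mono[OF 1] by blast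
    have "L - K \<subset> L" using \<open>C \<in> K\<close> C by blast
    have "\<exists>\<zeta> c' (l' :: 'a \<Rightarrow> 'b). linked c' l' ((\<Union>C\<in>L - K. Nf C (\<zeta> C)) \<union> (N \<union> F)) {} \<and>
           (\<forall>C\<in>L - K. \<zeta> C \<in> C \<and> (\<forall>v\<in>C. l' v = l' (\<zeta> C) \<longrightarrow> v = \<zeta> C)) \<and>
           (\<forall>w. (\<forall>a\<in>\<Union>(L - K). l1 a \<noteq> l1 w) \<longrightarrow> {v. l' v = l' w} = {v. l1 v = l1 w})"
    proof (rule psubset.IH[OF \<open>L - K \<subset> L\<close>])
      show "pairwise disjnt (L - K)"
        using pairwise_subset[OF psubset.prems(1)] by blast
      show "linked c1 l1 (N \<union> F) (\<Union>(L - K))" by (rule 1)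
      show "odd (card A)" if "A \<in> L - K" for A
        by (rule psubset.prems(2)) (use that in simp)
      show "matching (Nf A x) \<and> \<Union>(Nf A x) = A - {x}" if "A \<in> L - K" "x \<in> A" for A x
        by (rule psubset.prems(3)) (use that in simp_all)
    qed
    then obtain \<zeta>1 c2 and l2 :: "'a \<Rightarrow> 'b" where
      2: "linked c2 l2 ((\<Union>C\<in>L - K. Nf C (\<zeta>1 C)) \<union> (N \<union> F)) {}"
      and \<zeta>1: "\<forall>C\<in>L - K. \<zeta>1 C \<in> C \<and> (\<forall>v\<in>C. l2 v = l2 (\<zeta>1 C) \<longrightarrow> v = \<zeta>1 C)"
      and cl2: "\<forall>w. (\<forall>a\<in>\<Union>(L - K). l1 a \<noteq> l1 w) \<longrightarrow> {v. l2 v = l2 w} = {v. l1 v = l1 w}"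
      by (elim exE conjE) (rule that)
    have cl: "{v. l2 v = l2 w} = {v. l v = l w}"
      if "\<forall>a\<in>\<Union>N. l a \<noteq> l w" "\<forall>a\<in>\<Union>(L - K). l a \<noteq> l w" for w
    proof -
      have *: "{v. l1 v = l1 w} = {v. l v = l w}" by (rule cl1) (rule that(1))
      then have "\<forall>a\<in>\<Union>(L - K). l1 a \<noteq> l1 w" using that(2) by blast
      then show ?thesis using * cl2 by simp
    qed
    define \<zeta> where "\<zeta> A = (if A \<in> K then \<zeta>0 A else \<zeta>1 A)" for A
    have "(\<Union>C\<in>L - K. Nf C (\<zeta>1 C)) \<union> (N \<union> F) = (\<Union>C\<in>L. Nf C (\<zeta> C)) \<union> F"
      using \<open>K \<subseteq> L\<close> by (auto simp: N_def \<zeta>_def split: if_splits)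
    with 2 have "linked c2 l2 ((\<Union>C\<in>L. Nf C (\<zeta> C)) \<union> F) {}" by simp
    moreover have "\<zeta> A \<in> A \<and> (\<forall>v\<in>A. l2 v = l2 (\<zeta> A) \<longrightarrow> v = \<zeta> A)" if "A \<in> L" for A
    proof (cases "A \<in> K")
      case False
      then show ?thesis using \<zeta>1 that by (simp add: \<zeta>_def)
    next
      case True
      have lz: "l (\<zeta>0 A) = l z" using \<zeta>0[OF True] by (simp add: D_def)
      \<comment> \<open>Neither \<open>N\<close> nor an untreated cycle touches the component of
        \<open>z\<close>, so all later additions leave it alone.\<close>
      have cl0: "{v. l2 v = l2 (\<zeta>0 A)} = {v. l v = l (\<zeta>0 A)}"
      proof (rule cl)
        show "\<forall>a\<in>\<Union>N. l a \<noteq> l (\<zeta>0 A)" using UN \<open>\<Union>N \<subseteq> \<Union>L\<close> lz by (auto simp: D_def)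
        show "\<forall>a\<in>\<Union>(L - K). l a \<noteq> l (\<zeta>0 A)" using lz by (auto simp: D_def K_def)
      qed
      have "v = \<zeta>0 A" if v: "v \<in> A" "l2 v = l2 (\<zeta>0 A)" for v
      proof (rule one[OF \<open>A \<in> L\<close> _ \<zeta>0[OF True]])
        have "v \<in> {v. l v = l (\<zeta>0 A)}" using v(2) by (simp flip: cl0)
        then have "l v = l z" using lz by simp
        moreover have "v \<in> \<Union>L" using v(1) \<open>A \<in> L\<close> by (rule UnionI[rotated])
        ultimately show "v \<in> A \<inter> D" using v(1) by (simp add: D_def)
      qed
      then show ?thesis using True \<zeta>0[OF True] by (simp add: \<zeta>_def)
    qed
    moreover have "{v. l2 v = l2 w} = {v. l v = l w}" if "\<forall>a\<in>\<Union>L. l a \<noteq> l w" for w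
      by (rule cl) (use that \<open>\<Union>N \<subseteq> \<Union>L\<close> in blast)+
    ultimately show ?thesis by blast
  qed
qed

section \<open>Matchings of arcs in the orbits of a permutation\<close>

text \<open>Pairs up positions \<open>s\<close>, \<open>s + 1\<close>, then \<open>s + 2\<close>,
  \<open>s + 3\<close>, and so on. Even orbits use \<open>s = 0\<close>; odd orbits use
  \<open>s = 1\<close>, which leaves out just the starting vertex.\<close>

lemma matching_consecutive:
  assumes inj: "inj_on w {s..<n}" and "s \<le> n" "even (n - s)"
  shows "\<exists>N. matching N \<and> \<Union>N = w ` {s..<n} \<and> (\<forall>e\<in>N. \<exists>i. e = {w i, w (Suc i)})"
  using assms(2,3)
proof -
  define g where "g k = {w (s + 2 * k), w (Suc (s + 2 * k))}" for k
  obtain m where m: "n = s + 2 * m" using assms(2,3) by (metis evenE le_add_diff_inverse)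
  have inj': "i = j" if "w i = w j" "i \<in> {s..<n}" "j \<in> {s..<n}" for i j
    using inj that by (simp add: inj_on_def)
  have "matching (g ` {..<m})"
    unfolding matching_def
  proof (intro conjI ballI pairwiseI)
    fix e assume "e \<in> g ` {..<m}"
    then obtain k where k: "k < m" "e = g k" by blast
    then have "w (s + 2 * k) \<noteq> w (Suc (s + 2 * k))" using inj'[of "s + 2 * k" "Suc (s + 2 * k)"] m by auto
    then show "card e = 2" using k by (simp add: g_def)
  next
    fix e f assume "e \<in> g ` {..<m}" "f \<in> g ` {..<m}" "e \<noteq> f"
    then obtain k k' where k: "k < m" "e = g k" "k' < m" "f = g k'" "k \<noteq> k'" by blast
    have "w (s + 2 * k + i) \<noteq> w (s + 2 * k' + j)" if "i < 2" "j < 2" for i j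
    proof
      assume "w (s + 2 * k + i) = w (s + 2 * k' + j)"
      then have "s + 2 * k + i = s + 2 * k' + j" using k that m by (intro inj') auto
      then show False using that k(5) by presburger
    qed
    from this[of 0 0] this[of 0 1] this[of 1 0] this[of 1 1]
    show "disjnt e f" using k by (simp add: g_def disjnt_def)
  qed
  moreover have "\<Union>(g ` {..<m}) = w ` {s..<n}"
  proof (intro equalityI subsetI)
    fix x assume "x \<in> \<Union>(g ` {..<m})"
    then obtain k where k: "k < m" "x = w (s + 2 * k) \<or> x = w (Suc (s + 2 * k))" by (auto simp: g_def)
    then show "x \<in> w ` {s..<n}" using m by auto
  next
    fix x assume "x \<in> w ` {s..<n}"
    then obtain i where i: "x = w i" "s \<le> i" "i < n" by auto
    define k where "k = (i - s) div 2"
    have "i = s + 2 * k \<or> i = Suc (s + 2 * k)" using i(2) unfolding k_def by presburger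
    moreover have "k < m" using i m unfolding k_def by auto
    ultimately show "x \<in> \<Union>(g ` {..<m})" using i by (auto simp: g_def)
  qed
  moreover have "\<forall>e\<in>g ` {..<m}. \<exists>i. e = {w i, w (Suc i)}" by (auto simp: g_def)
  ultimately show ?thesis by blast
qed

lemma permutation_orbit_eq:
  assumes "permutation f" "z \<in> orbit f x"
  shows "orbit f z = orbit f x"
  using assms(2) permutation_self_in_orbit[OF assms(1)]
  by (metis orbit_swap orbit_trans subsetI subset_antisym)

lemma orbit_enum:
  assumes "permutation f"
  shows "inj_on (\<lambda>i. (f ^^ i) z) {0..<card (orbit f z)}"
    "orbit f z = (\<lambda>i. (f ^^ i) z) ` {0..<card (orbit f z)}"
proof -
  let ?n = "funpow_dist1 f z z"
  have s: "z \<in> orbit f z" by (rule permutation_self_in_orbit[OF assms])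
  have i: "inj_on (\<lambda>i. (f ^^ i) z) {0..<?n}" by (rule inj_on_funpow_dist1[OF s])
  have e: "orbit f z = (\<lambda>i. (f ^^ i) z) ` {0..<?n}" by (rule orbit_conv_funpow_dist1[OF s])
  have "card (orbit f z) = ?n" using card_image[OF i] e by simp
  then show "inj_on (\<lambda>i. (f ^^ i) z) {0..<card (orbit f z)}"
    "orbit f z = (\<lambda>i. (f ^^ i) z) ` {0..<card (orbit f z)}" using i e by auto
qed

lemma even_orbit_matching:
  assumes "permutation f" "even (card (orbit f z))"
  shows "\<exists>N. matching N \<and> \<Union>N = orbit f z \<and> (\<forall>e\<in>N. \<exists>x. e = {x, f x})"
proof -
  note o = orbit_enum[OF assms(1), of z]
  from matching_consecutive[OF o(1)] assms(2) obtain N where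
    N: "matching N" "\<Union>N = orbit f z" "\<forall>e\<in>N. \<exists>i. e = {(f ^^ i) z, (f ^^ Suc i) z}"
    using o(2) by auto
  have "\<forall>e\<in>N. \<exists>x. e = {x, f x}" using N(3) by fastforce
  then show ?thesis using N by blast
qed

lemma odd_orbit_matching:
  assumes "permutation f" "odd (card (orbit f z))"
  shows "\<exists>N. matching N \<and> \<Union>N = orbit f z - {z} \<and> (\<forall>e\<in>N. \<exists>x. e = {x, f x})"
proof -
  note o = orbit_enum[OF assms(1), of z]
  let ?n = "card (orbit f z)" and ?w = "\<lambda>i. (f ^^ i) z"
  have n: "1 \<le> ?n" "even (?n - 1)" using assms(2) by (auto simp: odd_pos Suc_le_eq)
  have i: "inj_on ?w {1..<?n}" by (rule inj_on_subset[OF o(1)]) auto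
  from matching_consecutive[OF i n] obtain N where
    N: "matching N" "\<Union>N = ?w ` {1..<?n}" "\<forall>e\<in>N. \<exists>i. e = {?w i, ?w (Suc i)}"
    by blast
  have "{0..<?n} = insert 0 {1..<?n}" using n(1) by auto
  then have "orbit f z = insert z (?w ` {1..<?n})" using o(2) by auto
  moreover have "z \<notin> ?w ` {1..<?n}"
  proof
    assume "z \<in> ?w ` {1..<?n}"
    then obtain i where "?w 0 = ?w i" "1 \<le> i" "i < ?n" by auto
    then show False using inj_onD[OF o(1), of 0 i] by auto
  qed
  ultimately have "\<Union>N = orbit f z - {z}" using N(2) by blast
  moreover have "\<forall>e\<in>N. \<exists>x. e = {x, f x}" using N(3) by fastforce
  ultimately show ?thesis using N by blast
qed

section \<open>Graphs of maximum degree two and their long odd cycles\<close>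

lemma simple_graphD:
  assumes "simple_graph V E"
  shows "finite V" "E u v \<Longrightarrow> u \<in> V" "E u v \<Longrightarrow> v \<in> V" "E u v \<Longrightarrow> u \<noteq> v" "E u v \<Longrightarrow> E v u"
  using assms unfolding simple_graph_def by blast+

lemma max_degree_two_neighbours:
  assumes G: "simple_graph V E" and "max_degree_le V E 2" and E: "E u x" "E u y" "E u z"
  shows "x = y \<or> x = z \<or> y = z"
proof (rule ccontr)
  assume "\<not> ?thesis"
  then have "card {x, y, z} = 3" by simp
  moreover have "{x, y, z} \<subseteq> {v \<in> V. E u v}" using E simple_graphD(3)[OF G] by blast
  then have "card {x, y, z} \<le> degree V E u"
    unfolding degree_def by (intro card_mono) (use simple_graphD(1)[OF G] in auto)
  ultimately show False
    using assms(2) simple_graphD(2)[OF G E(1)] unfolding max_degree_le_def by fastforce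
qed

text \<open>Paths and cycles are oriented consistently, which gives a partial injection on
  \<open>V\<close>. Equally many vertices lack a successor as lack a predecessor, so any bijection
  between the two sets completes it; the arcs so added need not be edges.\<close>

lemma max_degree_two_permutation:
  assumes G: "simple_graph V E" and "max_degree_le V E 2"
  shows "\<exists>f. f permutes V \<and> (\<forall>u v. E u v \<longrightarrow> v = f u \<or> u = f v)"
proof -
  note g = simple_graphD[OF G]
  note two = max_degree_two_neighbours[OF assms]
  \<comment> \<open>Darts are linked to their reversal (\<open>R\<close>) and to the other dart with the same tail (\<open>S\<close>);
    a 2-colouring is an orientation of \<open>E\<close> with in- and outdegrees at most 1.\<close>
  define R where "R d d' \<longleftrightarrow> E (fst d) (snd d) \<and> d' = (snd d, fst d)" for d d' :: "'a \<times> 'a"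
  define S where "S d d' \<longleftrightarrow> E (fst d) (snd d) \<and> E (fst d') (snd d') \<and> fst d = fst d' \<and> snd d \<noteq> snd d'"
    for d d' :: "'a \<times> 'a"
  have "\<exists>c. \<forall>d d'. R d d' \<or> S d d' \<longrightarrow> c d \<noteq> (c d' :: bool)"
  proof (rule two_relations_bipartite)
    show "finite (V \<times> V)" using g(1) by simp
    show "R d' d \<and> d \<noteq> d'" if "R d d'" for d d'
      using that g(4,5)[of "fst d" "snd d"] unfolding R_def by (cases d) auto
    show "d' = d''" if "R d d'" "R d d''" for d d' d''
      using that unfolding R_def by simp
    show "S d' d \<and> d \<noteq> d'" if "S d d'" for d d'
      using that unfolding S_def by auto
    show "d' = d''" if "S d d'" "S d d''" for d d' d''
    proof -
      have "E (fst d) (snd d)" "E (fst d) (snd d')" "E (fst d) (snd d'')" "snd d \<noteq> snd d'" "snd d \<noteq> snd d''"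
        "fst d' = fst d''"
        using that unfolding S_def by metis+
      then show ?thesis using two prod_eqI by blast
    qed
    show "d \<in> V \<times> V" if "S d d'" for d d'
      using that g(2,3)[of "fst d" "snd d"] unfolding S_def by (auto simp: mem_Times_iff)
  qed
  then obtain c where c: "\<And>d d'. R d d' \<or> S d d' \<Longrightarrow> c d \<noteq> (c d' :: bool)" by blast
  define D where "D u v \<longleftrightarrow> E u v \<and> c (u, v)" for u v
  have D1: "D u v \<or> D v u" if "E u v" for u v
    using c[of "(u, v)" "(v, u)"] that g(5)[OF that] unfolding D_def R_def by auto
  have D2: "v = w" if "D u v" "D u w" for u v w
    using c[of "(u, v)" "(u, w)"] that unfolding D_def S_def by auto
  have D3: "u = w" if "D u v" "D w v" for u v w
  proof (rule ccontr)
    assume "u \<noteq> w"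
    have e: "E u v" "E w v" "c (u, v)" "c (w, v)" using that by (auto simp: D_def)
    \<comment> \<open>Two arcs entering \<open>v\<close> would reverse to two darts with tail
      \<open>v\<close> and the same colour, contrary to \<open>S\<close>.\<close>
    then have "\<not> c (v, u)" "\<not> c (v, w)" using c[of "(u, v)" "(v, u)"] c[of "(w, v)" "(v, w)"]
      by (auto simp: R_def)
    then show False using c[of "(v, u)" "(v, w)"] e \<open>u \<noteq> w\<close> g(5) by (auto simp: S_def)
  qed
  define A where "A = {u. \<exists>v. D u v}"
  define h where "h u = (THE v. D u v)" for u
  have h: "h u = v" if "D u v" for u v
    unfolding h_def using that D2 by (intro the_equality) auto
  have Dh: "D u (h u)" if "u \<in> A" for u using that h unfolding A_def by blast
  have AV: "A \<subseteq> V" "h ` A \<subseteq> V" using Dh g(2,3) unfolding D_def by blast+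
  have "inj_on h A" using Dh D3 by (metis inj_onI)
  then have "card (V - A) = card (V - h ` A)"
    using AV g(1) by (simp add: card_Diff_subset finite_subset card_image)
  then obtain k where k: "bij_betw k (V - A) (V - h ` A)"
    using g(1) finite_same_card_bij by blast
  define f where "f v = (if v \<in> A then h v else if v \<in> V then k v else v)" for v
  have "bij_betw f A (h ` A)"
    using inj_on_imp_bij_betw[OF \<open>inj_on h A\<close>] by (rule bij_betw_cong[THEN iffD1, rotated]) (simp add: f_def)
  moreover have "bij_betw f (V - A) (V - h ` A)"
    using k by (rule bij_betw_cong[THEN iffD1, rotated]) (simp add: f_def)
  ultimately have "bij_betw f (A \<union> (V - A)) (h ` A \<union> (V - h ` A))"
    by (rule bij_betw_combine) blast
  moreover have "A \<union> (V - A) = V" "h ` A \<union> (V - h ` A) = V" using AV by blast+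
  ultimately have "f permutes V" using AV by (intro bij_imp_permutes) (auto simp: f_def)
  moreover have "v = f u \<or> u = f v" if "E u v" for u v
    using D1[OF that] h unfolding f_def A_def by auto
  ultimately show ?thesis by blast
qed

lemma component_subset:
  assumes "v \<in> V" shows "component V E v \<subseteq> V"
proof
  fix u assume "u \<in> component V E v"
  then have "(\<lambda>x y. x \<in> V \<and> y \<in> V \<and> E x y)\<^sup>*\<^sup>* v u" by (simp add: component_def)
  then show "u \<in> V" using assms by induction auto
qed

lemma component_eq:
  assumes G: "simple_graph V E" and "u \<in> component V E v"
  shows "component V E u = component V E v"
proof -
  let ?R = "\<lambda>x y. x \<in> V \<and> y \<in> V \<and> E x y"
  have "symp ?R" using simple_graphD(5)[OF G] by (auto simp: symp_def)
  then have s: "symp ?R\<^sup>*\<^sup>*" by (rule symp_rtranclp)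
  have 1: "?R\<^sup>*\<^sup>* v u" using assms(2) by (simp add: component_def)
  then have 2: "?R\<^sup>*\<^sup>* u v" using s by (simp add: symp_def)
  show ?thesis unfolding component_def using 1 2 by (auto intro: rtranclp_trans)
qed

lemma long_odd_cycles_eq:
  assumes G: "simple_graph V E"
    and "A \<in> long_odd_cycles V E" "B \<in> long_odd_cycles V E" "x \<in> A" "x \<in> B"
  shows "A = B"
proof -
  have "X = component V E x" if "X \<in> long_odd_cycles V E" "x \<in> X" for X
    using that component_eq[OF G] unfolding long_odd_cycles_def cycle_component_def by auto
  then show ?thesis using assms by metis
qed

text \<open>The cycles are disjoint and, being odd and longer than 3, have at least 5 vertices each.
  This is the source of the constant 9/10.\<close>

lemma card_long_odd_cycles:
  assumes G: "simple_graph V E"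
  shows "finite (long_odd_cycles V E)" "5 * card (long_odd_cycles V E) \<le> card V"
    "\<Union>(long_odd_cycles V E) \<subseteq> V"
proof -
  let ?L = "long_odd_cycles V E"
  have fV: "finite V" by (rule simple_graphD(1)[OF G])
  have "?L \<subseteq> component V E ` V"
    by (auto simp: long_odd_cycles_def cycle_component_def)
  then show fin: "finite ?L" using fV finite_surj by blast
  have sub: "C \<subseteq> V" if "C \<in> ?L" for C
    using that component_subset[of _ V E] by (auto simp: long_odd_cycles_def cycle_component_def)
  then show "\<Union>?L \<subseteq> V" by blast
  have "pairwise disjnt ?L"
    using long_odd_cycles_eq[OF G] unfolding pairwise_def disjnt_def by blast
  then have "card (\<Union>?L) = sum card ?L"
    using sub fV by (intro card_Union_disjoint) (auto intro: finite_subset)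
  moreover have "5 \<le> card C" if "C \<in> ?L" for C
  proof -
    have "odd (card C)" "3 < card C" using that by (auto simp: long_odd_cycles_def)
    then show ?thesis by presburger
  qed
  then have "card ?L * 5 \<le> sum card ?L" using sum_bounded_below[of ?L 5 card] by simp
  moreover have "card (\<Union>?L) \<le> card V" using sub fV by (intro card_mono) auto
  ultimately show "5 * card ?L \<le> card V" by simp
qed

text \<open>Edges join only consecutive vertices of an orbit, so an orbit all of whose arcs are
  edges is a full component. Successor and predecessor differ, as otherwise the orbit would have at
  most two elements.\<close>

lemma orbit_long_odd_cycle:
  assumes G: "simple_graph V E" and f: "f permutes V" "\<forall>u v. E u v \<longrightarrow> v = f u \<or> u = f v"
    and C: "v \<in> V" "C = orbit f v" "odd (card C)" "card C > 3" "\<And>x. x \<in> C \<Longrightarrow> E x (f x)"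
  shows "C \<in> long_odd_cycles V E"
proof -
  note g = simple_graphD[OF G]
  have p: "permutation f" using f(1) g(1) permutation_permutes by blast
  have inj: "f x = f y \<Longrightarrow> x = y" for x y using permutes_inj[OF f(1)] by (simp add: inj_eq)
  have pre: "\<exists>y\<in>C. f y = x" if "x \<in> C" for x
    using that permutation_self_in_orbit[OF p, of v] unfolding C(2) by cases auto
  let ?R = "\<lambda>x y. x \<in> V \<and> y \<in> V \<and> E x y"
  have fC: "f x \<in> C" if "x \<in> C" for x using that by (simp add: C(2) orbit.step)
  have vC: "v \<in> C" unfolding C(2) by (rule permutation_self_in_orbit[OF p])
  have "x \<in> C" if "?R\<^sup>*\<^sup>* v x" for x
    using that
  proof induction
    case base
    show ?case by (rule vC)
  next
    case (step x y)
    then consider "y = f x" | "x = f y" using f(2) by blast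
    then show ?case
    proof cases
      case 1
      then show ?thesis using step fC by blast
    next
      case 2
      then show ?thesis using pre[OF step.IH] inj by metis
    qed
  qed
  moreover have "?R\<^sup>*\<^sup>* v x" if "x \<in> orbit f v" for x
    using that
  proof induction
    case base
    have "E v (f v)" using C(5) vC by simp
    then show ?case using g(2,3) by blast
  next
    case (step y)
    then have "E y (f y)" using C(2,5) by simp
    then have "?R y (f y)" using g(2,3) by blast
    then show ?case using step.IH by (rule rtranclp.rtrancl_into_rtrancl[rotated])
  qed
  ultimately have comp: "C = component V E v" unfolding component_def C(2) by blast
  have "degree V E x = 2" if x: "x \<in> C" for x
  proof -
    obtain y where y: "y \<in> C" "f y = x" using pre[OF x] by blast
    have "E x (f x)" "E x y" using C(5) x y g(5) by blast+
    then have "{u \<in> V. E x u} = {f x, y}"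
      using f(2) inj y(2) g(3)[of x] by blast
    moreover have "f x \<noteq> y"
    proof
      assume "f x = y"
      then have two: "(f ^^ 2) x = x" using y(2) by (simp add: numeral_2_eq_2)
      have "orbit f x = {(f ^^ m) x |m. m < 2}"
        by (rule orbit_altdef_bounded[OF two]) simp
      also have "\<dots> = (\<lambda>m. (f ^^ m) x) ` {..<2}" by auto
      finally have "card (orbit f x) \<le> 2" using card_image_le[of "{..<2::nat}" "\<lambda>m. (f ^^ m) x"] by simp
      moreover have "orbit f x = C"
        unfolding C(2) by (rule permutation_orbit_eq[OF p]) (use x C(2) in simp)
      ultimately show False using C(4) by simp
    qed
    ultimately show ?thesis unfolding degree_def by simp
  qed
  then show ?thesis using C comp unfolding long_odd_cycles_def cycle_component_def by auto
qed

section \<open>Vertices with few neighbours of their own colour\<close>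

text \<open>Degree at most 1 inside the colour class, phrased as uniqueness so that the
  monochromatic edges directly form a matching.\<close>

definition mixed :: "('a \<Rightarrow> 'a \<Rightarrow> bool) \<Rightarrow> ('a \<Rightarrow> bool) \<Rightarrow> 'a \<Rightarrow> bool" where
  "mixed E c v \<longleftrightarrow> (\<forall>u w. E v u \<longrightarrow> E v w \<longrightarrow> c u = c v \<longrightarrow> c w = c v \<longrightarrow> u = w)"

text \<open>All neighbours of \<open>v\<close> are its successor or predecessor under
  \<open>f\<close>, and one of these two has the other colour.\<close>

lemma mixed_arc:
  assumes "inj f" "\<forall>u v. E u v \<longrightarrow> v = f u \<or> u = f v" and "c x \<noteq> c (f x)" "v = x \<or> v = f x"
  shows "mixed E c v"
  unfolding mixed_def
proof (intro allI impI)
  fix u w assume *: "E v u" "E v w" "c u = c v" "c w = c v"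
  have inj: "f a = f b \<Longrightarrow> a = b" for a b using assms(1) by (simp add: inj_eq)
  have "(u = f v \<or> v = f u) \<and> (w = f v \<or> v = f w)" using assms(2) * by blast
  then show "u = w" using assms(3,4) * inj by metis
qed

lemma mixed_no_arc:
  assumes "inj f" "\<forall>u v. E u v \<longrightarrow> v = f u \<or> u = f v" and "\<not> E v (f v)"
  shows "mixed E c v"
  unfolding mixed_def
proof (intro allI impI)
  fix u w assume *: "E v u" "E v w"
  have "v = f u" "v = f w" using assms(2,3) * by metis+
  then show "u = w" using assms(1) by (simp add: inj_eq)
qed

definition proper :: "('a \<Rightarrow> bool) \<Rightarrow> 'a set set \<Rightarrow> bool" where
  "proper c N \<longleftrightarrow> (\<forall>e\<in>N. \<forall>u\<in>e. \<forall>v\<in>e. u \<noteq> v \<longrightarrow> c u \<noteq> c v)"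

lemma properD:
  "proper c N \<Longrightarrow> e \<in> N \<Longrightarrow> u \<in> e \<Longrightarrow> v \<in> e \<Longrightarrow> u \<noteq> v \<Longrightarrow> c u \<noteq> c v"
  unfolding proper_def by blast

lemma proper_arc_mixed:
  assumes f: "inj f" "\<forall>u v. E u v \<longrightarrow> v = f u \<or> u = f v"
    and N: "matching N" "\<forall>e\<in>N. \<exists>x. e = {x, f x}" "proper c N" "v \<in> \<Union>N"
  shows "mixed E c v"
proof -
  obtain e where e: "e \<in> N" "v \<in> e" using N(4) by blast
  obtain x where x: "e = {x, f x}" using N(2) e by blast
  have "card e = 2" using N(1) e by (simp add: matching_def)
  then have "x \<noteq> f x" using x by auto
  then have "c x \<noteq> c (f x)" using x by (intro properD[OF N(3) e(1)]) auto
  then show ?thesis by (rule mixed_arc[OF f]) (use e x in auto)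
qed

text \<open>Three cases. An even orbit is matched completely. In an odd orbit with an arc outside
  \<open>E\<close>, the tail of that arc is left out; only its predecessor can be its neighbour.
  Otherwise the orbit is a triangle, and the vertex left out sees two vertices of different
  colours.\<close>

lemma short_orbit_matching:
  assumes f: "permutation f" "\<forall>u v. E u v \<longrightarrow> v = f u \<or> u = f v"
    and short: "\<not> (odd (card (orbit f x)) \<and> card (orbit f x) > 3 \<and> (\<forall>v\<in>orbit f x. E v (f v)))"
    and irr: "\<And>v. \<not> E v v"
  shows "\<exists>N. matching N \<and> \<Union>N \<subseteq> orbit f x \<and> (\<forall>c. proper c N \<longrightarrow> (\<forall>v\<in>orbit f x. mixed E c v))"
proof -
  have inj: "inj f" using f(1) permutation_bijective bij_is_inj by blast
  have orb: "orbit f z = orbit f x" if "z \<in> orbit f x" for z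
    by (rule permutation_orbit_eq[OF f(1) that])
  show ?thesis
  proof (cases "even (card (orbit f x))")
    case True
    from even_orbit_matching[OF f(1) True] obtain N where
      N: "matching N" "\<Union>N = orbit f x" "\<forall>e\<in>N. \<exists>x. e = {x, f x}" by blast
    have "mixed E c v" if "proper c N" "v \<in> orbit f x" for c v
      by (rule proper_arc_mixed[OF inj f(2) N(1,3) that(1)]) (simp_all add: N(2) that(2))
    then show ?thesis using N by blast
  next
    case odd: False
    show ?thesis
    proof (cases "\<forall>v\<in>orbit f x. E v (f v)")
      case False
      then obtain z where z: "z \<in> orbit f x" "\<not> E z (f z)" by blast
      from odd_orbit_matching[OF f(1), of z] odd orb[OF z(1)] obtain N where
        N: "matching N" "\<Union>N = orbit f x - {z}" "\<forall>e\<in>N. \<exists>x. e = {x, f x}" by auto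
      have "mixed E c v" if "proper c N" "v \<in> orbit f x" for c v
      proof (cases "v = z")
        case True
        show ?thesis unfolding True by (rule mixed_no_arc[OF inj f(2) z(2)])
      next
        case False
        show ?thesis
          by (rule proper_arc_mixed[OF inj f(2) N(1,3) that(1)]) (simp_all add: N(2) that(2) False)
      qed
      then show ?thesis using N by blast
    next
      case True
      then have le: "card (orbit f x) \<le> 3" using short odd by auto
      have xx: "x \<in> orbit f x" by (rule permutation_self_in_orbit[OF f(1)])
      from odd_orbit_matching[OF f(1) odd] obtain N where
        N: "matching N" "\<Union>N = orbit f x - {x}" "\<forall>e\<in>N. \<exists>x. e = {x, f x}" by blast
      have fx: "f x \<in> orbit f x" "f (f x) \<in> orbit f x" by (auto intro: orbit.intros)
      have nf: "v \<noteq> f v" if "v \<in> orbit f x" for v using True that irr by metis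
      have "f (f x) \<noteq> x"
      proof
        assume "f (f x) = x"
        then have "(f ^^ 2) x = x" by (simp add: numeral_2_eq_2)
        then have "orbit f x = {(f ^^ m) x |m. m < 2}" by (rule orbit_altdef_bounded) simp
        also have "\<dots> = {x, f x}" by (auto simp: less_2_cases_iff intro: exI[of _ 0] exI[of _ 1])
        finally show False using odd nf[OF xx] by simp
      qed
      then have d: "card {x, f x, f (f x)} = 3" using nf[OF xx] nf[OF fx(1)] by auto
      have "finite (orbit f x)" using odd card.infinite by fastforce
      then have O: "orbit f x = {x, f x, f (f x)}"
        using d le xx fx by (intro card_seteq[symmetric]) auto
      have UN: "\<Union>N = {f x, f (f x)}" using N(2) O \<open>f (f x) \<noteq> x\<close> nf[OF xx] by auto
      have "mixed E c v" if c: "proper c N" and v: "v \<in> orbit f x" for c v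
      proof (cases "v = x")
        case False
        show ?thesis
          by (rule proper_arc_mixed[OF inj f(2) N(1,3) c]) (simp_all add: N(2) v False)
      next
        case True
        obtain e where e: "e \<in> N" "f x \<in> e" using UN by blast
        have "e \<subseteq> {f x, f (f x)}" using UN e(1) by blast
        moreover have "card e = 2" using N(1) e(1) by (simp add: matching_def)
        \<comment> \<open>The matching consists of the edge opposite to \<open>x\<close>, so the two
          neighbours of \<open>x\<close> get different colours.\<close>
        ultimately have "e = {f x, f (f x)}"
          using nf[OF fx(1)] by (intro card_subset_eq) auto
        then have cc: "c (f x) \<noteq> c (f (f x))"
          by (intro properD[OF c e(1) _ _ nf[OF fx(1)]]) auto
        have nb: "u = f x \<or> u = f (f x)" if "E x u" for u
        proof -
          from f(2)[rule_format, OF that] show ?thesis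
          proof
            assume "x = f u"
            then have "x \<in> orbit f u" by (metis orbit.base)
            then have "u \<in> orbit f x" using permutation_self_in_orbit[OF f(1)] orbit_swap by metis
            then show ?thesis using O irr[of x] that by auto
          qed simp
        qed
        show ?thesis unfolding mixed_def True
          using nb cc by metis
      qed
      then show ?thesis using N by blast
    qed
  qed
qed

section \<open>The first 2-colouring and the set of deleted vertices\<close>

text \<open>\<open>Z\<close> consists of the exceptional vertices that agree in colour with their
  successor. Properness is kept on all of \<open>P\<close>, also on edges meeting \<open>Z\<close>,
  so that every clique is still cut into halves.\<close>

lemma bisecting_colouring:
  assumes G: "simple_graph V E" and "max_degree_le V E 2" and P: "matching P"
  shows "\<exists>Z c. Z \<subseteq> \<Union>(long_odd_cycles V E) \<and> 2 * card Z \<le> card (long_odd_cycles V E) \<and>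
    (\<forall>C\<in>long_odd_cycles V E. card (Z \<inter> C) \<le> 1) \<and> proper c P \<and> (\<forall>v\<in>V - Z. mixed E c v)"
proof -
  let ?L = "long_odd_cycles V E"
  note g = simple_graphD[OF G]
  from max_degree_two_permutation[OF assms(1,2)] obtain f where
    fV: "f permutes V" and fE: "\<forall>u v. E u v \<longrightarrow> v = f u \<or> u = f v" by blast
  have p: "permutation f" using fV g(1) permutation_permutes by blast
  have inj: "inj f" by (rule permutes_inj[OF fV])
  have irr: "\<not> E v v" for v using g(4) by blast
  have self: "v \<in> orbit f v" for v by (rule permutation_self_in_orbit[OF p])
  have orb: "orbit f z = orbit f x" if "z \<in> orbit f x" for x z
    by (rule permutation_orbit_eq[OF p that])
  define Q where "Q = orbit f ` V"
  define K where "K = {C\<in>Q. odd (card C) \<and> card C > 3 \<and> (\<forall>v\<in>C. E v (f v))}"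
  have dj: "pairwise disjnt Q"
    unfolding pairwise_def disjnt_def Q_def using orb by blast
  have QV: "C \<subseteq> V" if "C \<in> Q" for C
    using that permutes_orbit_subset[OF fV] by (auto simp: Q_def)
  have Qorb: "C = orbit f v" if "C \<in> Q" "v \<in> C" for C v
    using that orb by (auto simp: Q_def)
  have fin: "finite Q" "finite K" using g(1) by (auto simp: Q_def K_def)
  have KL: "K \<subseteq> ?L"
  proof
    fix C assume C: "C \<in> K"
    then obtain v where "v \<in> V" "C = orbit f v" by (auto simp: K_def Q_def)
    then show "C \<in> ?L"
      by (rule orbit_long_odd_cycle[OF G fV fE]) (use C in \<open>auto simp: K_def\<close>)
  qed
  have "\<exists>N. matching N \<and> \<Union>N \<subseteq> C \<and> (\<forall>c. proper c N \<longrightarrow> (\<forall>v\<in>C. mixed E c v))" if C: "C \<in> Q - K" for C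
  proof -
    obtain x where x: "C = orbit f x" using C by (auto simp: Q_def)
    show ?thesis unfolding x
      by (rule short_orbit_matching[OF p fE _ irr]) (use C x in \<open>auto simp: K_def\<close>)
  qed
  then obtain M where M: "\<And>C. C \<in> Q - K \<Longrightarrow> matching (M C)" "\<And>C. C \<in> Q - K \<Longrightarrow> \<Union>(M C) \<subseteq> C"
    "\<And>C c v. C \<in> Q - K \<Longrightarrow> proper c (M C) \<Longrightarrow> v \<in> C \<Longrightarrow> mixed E c v" by metis
  have "\<exists>N. matching N \<and> \<Union>N = C - {z} \<and> (\<forall>e\<in>N. \<exists>x. e = {x, f x})" if "C \<in> K" "z \<in> C" for C z
  proof -
    have "C = orbit f z" "odd (card C)" using that Qorb by (auto simp: K_def)
    then show ?thesis using odd_orbit_matching[OF p, of z] by simp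
  qed
  then obtain R where R: "\<And>C z. C \<in> K \<Longrightarrow> z \<in> C \<Longrightarrow> matching (R C z)"
    "\<And>C z. C \<in> K \<Longrightarrow> z \<in> C \<Longrightarrow> \<Union>(R C z) = C - {z}"
    "\<And>C z. C \<in> K \<Longrightarrow> z \<in> C \<Longrightarrow> \<forall>e\<in>R C z. \<exists>x. e = {x, f x}" by metis
  define N where "N = (\<Union>C\<in>Q - K. M C)"
  have mN: "matching N" unfolding N_def
    by (rule matching_UN[OF pairwise_subset[OF dj]]) (use M(1,2) in auto)
  have UN: "\<Union>N \<subseteq> \<Union>(Q - K)" unfolding N_def using M(2) by blast
  have "\<Union>N \<subseteq> V" using UN QV by blast
  then have "finite (\<Union>N)" using g(1) by (rule finite_subset)
  then have fN: "finite N" by (rule finite_UnionD)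
  obtain c0 and l0 :: "'a \<Rightarrow> 'a set" where "linked c0 l0 P UNIV"
    using linked_matching[OF P] by blast
  from linked_add_matching[OF fN mN this subset_UNIV]
  obtain c1 and l1 :: "'a \<Rightarrow> 'a set" where 1: "linked c1 l1 (N \<union> P) (UNIV - \<Union>N)" by blast
  have KQ: "K \<subseteq> Q" by (auto simp: K_def)
  have "A = B" if "A \<in> K" "B \<in> Q" "x \<in> A" "x \<in> B" for A B x
    using Qorb[of A x] Qorb[of B x] that KQ by auto
  then have "\<Union>K \<inter> \<Union>(Q - K) = {}" by blast
  then have "\<Union>K \<subseteq> UNIV - \<Union>N" using UN by blast
  \<comment> \<open>From here on only vertices of the cycles in \<open>K\<close> count as free; what
    \<open>N\<close> left uncovered in the other orbits is already harmless.\<close>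
  then have 1: "linked c1 l1 (N \<union> P) (\<Union>K)" by (rule linked_mono[OF 1 order_refl])
  have "\<exists>\<zeta> c' (l' :: 'a \<Rightarrow> 'a set). linked c' l' ((\<Union>C\<in>K. R C (\<zeta> C)) \<union> (N \<union> P)) {} \<and>
           (\<forall>C\<in>K. \<zeta> C \<in> C \<and> (\<forall>v\<in>C. l' v = l' (\<zeta> C) \<longrightarrow> v = \<zeta> C)) \<and>
           (\<forall>w. (\<forall>a\<in>\<Union>K. l1 a \<noteq> l1 w) \<longrightarrow> {v. l' v = l' w} = {v. l1 v = l1 w})"
    by (rule linked_resolve_odd[OF fin(2) pairwise_subset[OF dj KQ] _ _ 1])
      (simp add: K_def, simp add: R(1,2))
  then obtain \<zeta> c2 and l2 :: "'a \<Rightarrow> 'a set" where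
    2: "linked c2 l2 ((\<Union>C\<in>K. R C (\<zeta> C)) \<union> (N \<union> P)) {}"
    and \<zeta>: "\<forall>C\<in>K. \<zeta> C \<in> C \<and> (\<forall>v\<in>C. l2 v = l2 (\<zeta> C) \<longrightarrow> v = \<zeta> C)"
    by (elim exE conjE) (rule that)
  have \<zeta>C: "\<zeta> C \<in> C" "f (\<zeta> C) \<in> C" "l2 (\<zeta> C) \<noteq> l2 (f (\<zeta> C))" if C: "C \<in> K" for C
  proof -
    show z: "\<zeta> C \<in> C" using \<zeta> C by blast
    have "C = orbit f (\<zeta> C)" using Qorb[of C] C z KQ by blast
    then show fz: "f (\<zeta> C) \<in> C" using orbit.base[of f "\<zeta> C"] by simp
    have "E (\<zeta> C) (f (\<zeta> C))" using C z by (simp add: K_def)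
    then have "f (\<zeta> C) \<noteq> \<zeta> C" using irr by metis
    then show "l2 (\<zeta> C) \<noteq> l2 (f (\<zeta> C))" using \<zeta> C fz by metis
  qed
  \<comment> \<open>An exceptional vertex and its successor lie on the same cycle, hence in
    different components, which can be flipped independently.\<close>
  let ?a = "\<lambda>C. l2 (\<zeta> C)" and ?b = "\<lambda>C. l2 (f (\<zeta> C))"
  let ?t = "\<lambda>C. c2 (\<zeta> C) \<noteq> c2 (f (\<zeta> C))"
  have "\<exists>s :: 'a set \<Rightarrow> bool. 2 * card {C\<in>K. (s (?a C) \<noteq> s (?b C)) = ?t C} \<le> card K"
    by (rule signs_half[of "?a ` K \<union> ?b ` K" K]) (use fin(2) \<zeta>C(3) in auto)
  then obtain s :: "'a set \<Rightarrow> bool" where s: "2 * card {C\<in>K. (s (?a C) \<noteq> s (?b C)) = ?t C} \<le> card K"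
    by blast
  \<comment> \<open>These are the cycles on which, after flipping by \<open>s\<close>, the
    exceptional vertex and its successor have equal colours.\<close>
  define B where "B = {C\<in>K. (s (?a C) \<noteq> s (?b C)) = ?t C}"
  \<comment> \<open>Whole components are flipped, so every edge of the two matchings stays properly
    coloured.\<close>
  define c where "c v \<longleftrightarrow> (c2 v \<noteq> s (l2 v))" for v
  have cF: "proper c ((\<Union>C\<in>K. R C (\<zeta> C)) \<union> (N \<union> P))"
    unfolding proper_def
  proof (intro ballI impI)
    fix e u v assume *: "e \<in> (\<Union>C\<in>K. R C (\<zeta> C)) \<union> (N \<union> P)" "u \<in> e" "v \<in> e" "u \<noteq> v"
    show "c u \<noteq> c v" using linkedD[OF 2 *] unfolding c_def by simp
  qed
  have sub: "proper c X" if "X \<subseteq> (\<Union>C\<in>K. R C (\<zeta> C)) \<union> (N \<union> P)" for X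
    using cF that unfolding proper_def by blast
  have "mixed E c v" if v: "v \<in> V - \<zeta> ` B" for v
  proof (cases "orbit f v \<in> K")
    case False
    then have C: "orbit f v \<in> Q - K" using v by (simp add: Q_def)
    have "M (orbit f v) \<subseteq> N" using C by (auto simp: N_def)
    then have "proper c (M (orbit f v))" by (intro sub) blast
    then show ?thesis using M(3)[OF C] self by blast
  next
    case True
    let ?C = "orbit f v"
    show ?thesis
    proof (cases "v = \<zeta> ?C")
      case False
      have "proper c (R ?C (\<zeta> ?C))" by (rule sub) (use True in blast)
      then show ?thesis
        by (rule proper_arc_mixed[OF inj fE R(1)[OF True \<zeta>C(1)[OF True]] R(3)[OF True \<zeta>C(1)[OF True]]])
          (simp_all add: R(2)[OF True \<zeta>C(1)[OF True]] self False)
    next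
      case eq: True
      then have "?C \<notin> B" using v by blast
      then have "c (\<zeta> ?C) \<noteq> c (f (\<zeta> ?C))" using True unfolding B_def c_def by auto
      then show ?thesis by (rule mixed_arc[OF inj fE]) (use eq in simp)
    qed
  qed
  moreover have "\<zeta> ` B \<subseteq> \<Union>?L" using \<zeta>C(1) KL by (auto simp: B_def)
  moreover have "2 * card (\<zeta> ` B) \<le> card ?L"
  proof -
    have "finite B" using fin(2) by (simp add: B_def)
    then have "card (\<zeta> ` B) \<le> card B" by (rule card_image_le)
    moreover have "card K \<le> card ?L" by (rule card_mono[OF card_long_odd_cycles(1)[OF G] KL])
    ultimately show ?thesis using s unfolding B_def by linarith
  qed
  moreover have "card (\<zeta> ` B \<inter> C) \<le> 1" if C: "C \<in> ?L" for C
  proof -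
    have "\<zeta> ` B \<inter> C \<subseteq> {\<zeta> C}"
    proof
      fix x assume "x \<in> \<zeta> ` B \<inter> C"
      then obtain A where A: "A \<in> K" "x = \<zeta> A" "x \<in> C" by (auto simp: B_def)
      then have "A = C" using long_odd_cycles_eq[OF G _ C, of A x] KL \<zeta>C(1) by blast
      then show "x \<in> {\<zeta> C}" using A by simp
    qed
    then have "card (\<zeta> ` B \<inter> C) \<le> card {\<zeta> C}" by (rule card_mono[rotated]) simp
    then show ?thesis by simp
  qed
  moreover have "proper c P" by (rule sub) blast
  ultimately show ?thesis by blast
qed

section \<open>The 4-colouring of the glued graph\<close>

theorem theorem2p1:
  fixes V :: "'a set" and E :: "'a \<Rightarrow> 'a \<Rightarrow> bool"
    and Y :: "nat \<Rightarrow> 'a set" and q :: nat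
  assumes "simple_graph V E"
    and "max_degree_le V E 2"
    and "\<forall>j<q. Y j \<subseteq> V \<and> card (Y j) = 4"
    and "\<forall>i<q. \<forall>j<q. i \<noteq> j \<longrightarrow> Y i \<inter> Y j = {}"
  shows "\<exists>Z. Z \<subseteq> \<Union>(long_odd_cycles V E)
           \<and> real (card Z) \<le> real (card (long_odd_cycles V E)) / 2
           \<and> colorable (V - Z) (glue_cliques E Y q) 4
           \<and> (\<forall>C\<in>long_odd_cycles V E. card (Z \<inter> C) \<le> 1)
           \<and> real (card (V - Z)) \<ge> 9 / 10 * real (card V)"
proof -
  let ?L = "long_odd_cycles V E"
  note g = simple_graphD[OF assms(1)]
  have Yd: "i = j" if "x \<in> Y i" "x \<in> Y j" "i < q" "j < q" for i j x
    using assms(4) that by blast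
  have "\<exists>B. B \<subseteq> Y j \<and> card B = 2 \<and> card (Y j - B) = 2" if "j < q" for j
  proof -
    have 4: "card (Y j) = 4" using assms(3) that by blast
    then obtain B where B: "B \<subseteq> Y j" "card B = 2" "finite B"
      using obtain_subset_with_card_n[of 2 "Y j"] by auto
    then have "card (Y j - B) = 2" using 4 by (simp add: card_Diff_subset)
    then show ?thesis using B by blast
  qed
  then obtain B where B: "\<And>j. j < q \<Longrightarrow> B j \<subseteq> Y j" "\<And>j. j < q \<Longrightarrow> card (B j) = 2"
    "\<And>j. j < q \<Longrightarrow> card (Y j - B j) = 2" by metis
  \<comment> \<open>The two halves of every clique, grouped by clique so that disjointness of the
    cliques makes their union a matching.\<close>
  define P where "P = (\<Union>C\<in>Y ` {..<q}. {e. \<exists>j<q. C = Y j \<and> (e = B j \<or> e = Y j - B j)})"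
  have "matching P"
    unfolding P_def
  proof (rule matching_UN)
    show "pairwise disjnt (Y ` {..<q})"
      unfolding pairwise_def disjnt_def using assms(4) by blast
  next
    fix C assume "C \<in> Y ` {..<q}"
    then obtain j where j: "j < q" "C = Y j" by blast
    have "Y j \<noteq> {}" using assms(3) j(1) by fastforce
    then have "k = j" if "k < q" "Y j = Y k" for k using Yd[of _ k j] that j(1) by blast
    then have "{e. \<exists>j<q. C = Y j \<and> (e = B j \<or> e = Y j - B j)} = {B j, Y j - B j}" using j by blast
    moreover have "matching {B j, Y j - B j}"
      using B[OF j(1)] by (auto simp: matching_def pairwise_def disjnt_def)
    ultimately show "matching {e. \<exists>j<q. C = Y j \<and> (e = B j \<or> e = Y j - B j)}" by simp
    show "\<Union>{e. \<exists>j<q. C = Y j \<and> (e = B j \<or> e = Y j - B j)} \<subseteq> C" using B(1) by blast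
  qed
  from bisecting_colouring[OF assms(1,2) this] obtain Z c where
    Z: "Z \<subseteq> \<Union>?L" "2 * card Z \<le> card ?L" "\<forall>C\<in>?L. card (Z \<inter> C) \<le> 1"
    and c: "proper c P" "\<forall>v\<in>V - Z. mixed E c v" by (elim exE conjE) (rule that)
  have PB: "B j \<in> P" "Y j - B j \<in> P" if "j < q" for j using that by (auto simp: P_def)
  have cB: "u = v" if "j < q" "u \<in> Y j" "v \<in> Y j" "c u = c v" "u \<in> B j \<longleftrightarrow> v \<in> B j" for j u v
    using that c(1) PB[OF that(1)] unfolding proper_def by (metis DiffI)
  \<comment> \<open>Each half of \<open>Y j\<close> contains both colours, so a colour class meets
    \<open>Y j\<close> in one vertex from each half; \<open>S\<close> joins these two.
    \<open>T\<close> consists of the monochromatic edges outside \<open>Z\<close> and has unique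
    partners because these vertices are mixed.\<close>
  define S where "S u v \<longleftrightarrow> u \<noteq> v \<and> c u = c v \<and> (\<exists>j<q. u \<in> Y j \<and> v \<in> Y j)" for u v
  define T where "T u v \<longleftrightarrow> E u v \<and> c u = c v \<and> u \<in> V - Z \<and> v \<in> V - Z" for u v
  have "\<exists>d. \<forall>u v. S u v \<or> T u v \<longrightarrow> d u \<noteq> (d v :: bool)"
  proof (rule two_relations_bipartite)
    show "finite V" by (rule g(1))
    show "S v u \<and> u \<noteq> v" if "S u v" for u v using that by (auto simp: S_def)
    show "v = w" if S: "S u v" "S u w" for u v w
    proof -
      obtain j where j: "j < q" "u \<in> Y j" "v \<in> Y j" using S(1) by (auto simp: S_def)
      obtain k where k: "k < q" "u \<in> Y k" "w \<in> Y k" using S(2) by (auto simp: S_def)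
      have w: "w \<in> Y j" using Yd[OF j(2) k(2) j(1) k(1)] k(3) by simp
      have e: "c u = c v" "c u = c w" "u \<noteq> v" "u \<noteq> w" using S by (auto simp: S_def)
      have "(u \<in> B j) \<noteq> (v \<in> B j)" using cB[OF j] e by blast
      moreover have "(u \<in> B j) \<noteq> (w \<in> B j)" using cB[OF j(1,2) w] e by blast
      ultimately show ?thesis using cB[OF j(1,3) w] e by simp
    qed
    show "T v u \<and> u \<noteq> v" if "T u v" for u v
      using that g(4,5)[of u v] by (simp add: T_def)
    show "v = w" if "T u v" "T u w" for u v w
    proof -
      have "mixed E c u" using that c(2) by (simp add: T_def)
      then show ?thesis using that unfolding mixed_def T_def by metis
    qed
    show "u \<in> V" if "T u v" for u v using that by (simp add: T_def)
  qed
  then obtain d where d: "\<And>u v. S u v \<or> T u v \<Longrightarrow> d u \<noteq> (d v :: bool)" by blast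
  \<comment> \<open>The pair of bits \<open>c\<close>, \<open>d\<close> read in binary. Adjacent
    vertices agreeing in \<open>c\<close> are related by \<open>S\<close> or \<open>T\<close>, hence
    differ in \<open>d\<close>.\<close>
  define h where "h v = (if c v then 2 else 0) + (if d v then 1 else 0 :: nat)" for v
  have h: "c u = c v \<and> d u = d v" if "h u = h v" for u v
    using that by (simp add: h_def split: if_splits)
  have "colorable (V - Z) (glue_cliques E Y q) 4"
    unfolding colorable_def
  proof (intro exI[of _ h] conjI ballI impI)
    fix u v assume uv: "u \<in> V - Z" "v \<in> V - Z" "glue_cliques E Y q u v"
    show "h u \<noteq> h v"
    proof
      assume "h u = h v"
      then have "c u = c v" "d u = d v" using h by blast+
      then show False using uv d[of u v] unfolding glue_cliques_def S_def T_def by blast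
    qed
  qed (simp add: h_def)
  moreover have "real (card (V - Z)) \<ge> 9 / 10 * real (card V)"
  proof -
    \<comment> \<open>Twice \<open>card Z\<close> is at most the number of long odd cycles, and five
      times that number is at most \<open>card V\<close>.\<close>
    have "10 * card Z \<le> card V" using Z(2) card_long_odd_cycles(2)[OF assms(1)] by linarith
    moreover have "finite Z" using Z(1) card_long_odd_cycles(3)[OF assms(1)] g(1) by (meson finite_subset)
    then have "card V - card Z \<le> card (V - Z)" by (rule diff_card_le_card_Diff)
    ultimately show ?thesis by linarith
  qed
  moreover have "real (card Z) \<le> real (card ?L) / 2" using Z(2) by linarith
  ultimately show ?thesis using Z by blast
qed

end
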